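(* Let $\alpha: I\to E^3$ be a Frenet curve with Frenet frame $\{T,N,B\}$ and torsion $\tau$, and let $\beta$ be an evolute-direction curve of $\alpha$ with Frenet frame $\{\overline T,\overline N,\overline B\}$. Then, for a suitable antiderivative $\int\tau\,ds$ of $\tau$, $$\overline T(s)=\sin\left(\int\tau\,ds\right)N(s)+\cos\left(\int\tau\,ds\right)B(s),\qquad \overline N(s)=T(s),$$ $$\overline B(s)=\cos\left(\int\tau\,ds\right)N(s)-\sin\left(\int\tau\,ds\right)B(s).$$
   Context: $I\subset\mathbb{R}$ is an open interval and curves are smooth. A unit speed curve $\alpha:I\to E^3$ is a Frenet curve if its curvature $\kappa=\|\alpha''\|$ is nowhere zero; then $T=\alpha'$, $N=\alpha''/\kappa$, $B=T\times N$, and $T'=\kappa N$, $N'=-\kappa T+\tau B$, $B'=-\tau N$, where $\tau$ is the torsion. For a unit vector field $X(s)=a(s)T(s)+b(s)N(s)+c(s)B(s)$ with $a,b,c$ smooth and $a^2+b^2+c^2=1$, an $X$-direction curve of $\alpha$ is a curve $\beta:I\to E^3$ with $\beta'(s)=X(s)$; the parameter $s$ is then also arc length for $\beta$. The Frenet vectors of $\beta$ are defined in the same way ($\overline T=\beta'$, $\overline\kappa=\|\beta''\|$, $\overline N=\beta''/\overline\kappa$, $\overline B=\overline T\times\overline N$). An $X$-direction curve $\beta$ of $\alpha$ (for some such $X$) is called an evolute-direction curve of $\alpha$ if it is an evolute of $\alpha$, in the sense that $\beta$ is a Frenet curve with $\langle\overline T,T\rangle=0$ and $\overline N=T$ at each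 common parameter value $s$. *)

theory Defs
  imports "HOL-Analysis.Analysis"
begin

(* Meant for open I only: there the two-sided derivative at s depends just on f restricted to I. *)
definition smooth_on :: "real set \<Rightarrow> (real \<Rightarrow> 'a::real_normed_vector) \<Rightarrow> bool" where
  "smooth_on I f \<longleftrightarrow>
     (\<forall>k::nat. ((\<lambda>g s. vector_derivative g (at s)) ^^ k) f differentiable_on I)"

definition tangent :: "(real \<Rightarrow> real^3) \<Rightarrow> real \<Rightarrow> real^3" where
  "tangent \<alpha> s = vector_derivative \<alpha> (at s)"

definition curvature :: "(real \<Rightarrow> real^3) \<Rightarrow> real \<Rightarrow> real" where
  "curvature \<alpha> s = norm (vector_derivative (tangent \<alpha>) (at s))"

definition normal :: "(real \<Rightarrow> real^3) \<Rightarrow> real \<Rightarrow> real^3" where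
  "normal \<alpha> s = vector_derivative (tangent \<alpha>) (at s) /\<^sub>R curvature \<alpha> s"

definition binormal :: "(real \<Rightarrow> real^3) \<Rightarrow> real \<Rightarrow> real^3" where
  "binormal \<alpha> s = cross3 (tangent \<alpha> s) (normal \<alpha> s)"

(* The coefficient tau in the Frenet equation B' = - tau N, extracted by pairing with the
   unit vector N. *)
definition torsion :: "(real \<Rightarrow> real^3) \<Rightarrow> real \<Rightarrow> real" where
  "torsion \<alpha> s = - (vector_derivative (binormal \<alpha>) (at s) \<bullet> normal \<alpha> s)"

definition frenet_curve :: "real set \<Rightarrow> (real \<Rightarrow> real^3) \<Rightarrow> bool" where
  "frenet_curve I \<alpha> \<longleftrightarrow>
     smooth_on I \<alpha> \<and> (\<forall>s\<in>I. norm (tangent \<alpha> s) = 1) \<and> (\<forall>s\<in>I. curvature \<alpha> s \<noteq> 0)"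

definition unit_frenet_field ::
    "real set \<Rightarrow> (real \<Rightarrow> real^3) \<Rightarrow> (real \<Rightarrow> real^3) \<Rightarrow> bool" where
  "unit_frenet_field I \<alpha> X \<longleftrightarrow>
     (\<exists>a b c :: real \<Rightarrow> real.
        smooth_on I a \<and> smooth_on I b \<and> smooth_on I c \<and>
        (\<forall>s\<in>I. (a s)\<^sup>2 + (b s)\<^sup>2 + (c s)\<^sup>2 = 1 \<and>
               X s = a s *\<^sub>R tangent \<alpha> s + b s *\<^sub>R normal \<alpha> s + c s *\<^sub>R binormal \<alpha> s))"

definition direction_curve ::
    "real set \<Rightarrow> (real \<Rightarrow> real^3) \<Rightarrow> (real \<Rightarrow> real^3) \<Rightarrow> (real \<Rightarrow> real^3) \<Rightarrow> bool" where
  "direction_curve I \<alpha> X \<beta> \<longleftrightarrow>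
     unit_frenet_field I \<alpha> X \<and> smooth_on I \<beta> \<and>
     (\<forall>s\<in>I. (\<beta> has_vector_derivative X s) (at s))"

(* This notion compares the Frenet frames at equal parameter values; it does not require
   the tangent lines of \<beta> to pass through the corresponding points of \<alpha>. *)
definition evolute_of :: "real set \<Rightarrow> (real \<Rightarrow> real^3) \<Rightarrow> (real \<Rightarrow> real^3) \<Rightarrow> bool" where
  "evolute_of I \<alpha> \<beta> \<longleftrightarrow>
     frenet_curve I \<beta> \<and>
     (\<forall>s\<in>I. tangent \<beta> s \<bullet> tangent \<alpha> s = 0 \<and> normal \<beta> s = tangent \<alpha> s)"

definition evolute_direction_curve ::
    "real set \<Rightarrow> (real \<Rightarrow> real^3) \<Rightarrow> (real \<Rightarrow> real^3) \<Rightarrow> bool" where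
  "evolute_direction_curve I \<alpha> \<beta> \<longleftrightarrow>
     (\<exists>X. direction_curve I \<alpha> X \<beta>) \<and> evolute_of I \<alpha> \<beta>"

end

theory Submission
  imports Defs
begin

text \<open>
  Write the unit tangent of \<open>\<beta>\<close> as \<open>b N + c B\<close>: it has no \<open>T\<close>-component because it is orthogonal
  to the tangent of \<open>\<alpha>\<close>. The derivative of the tangent of \<open>\<beta>\<close> is a multiple of the normal of \<open>\<beta>\<close>,
  which is \<open>T\<close> and hence orthogonal to \<open>N\<close> and \<open>B\<close>. Differentiating \<open>b\<close> and \<open>c\<close>, the inner products
  of the tangent of \<open>\<beta>\<close> with \<open>N\<close> and \<open>B\<close>, therefore only sees the rotation of \<open>N\<close> and \<open>B\<close> about
  \<open>T\<close>, whose rate is the torsion: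
  \<open>b' = \<tau> c\<close> and \<open>c' = - \<tau> b\<close> (lemma \<open>evolute_tangent_coordinates\<close>).

  So \<open>(b, c)\<close> is a point of the unit circle that moves with angular velocity \<open>\<tau>\<close>. Its angle is an
  antiderivative of \<open>\<tau>\<close> whose constant is fixed by the position at one parameter value
  (lemma \<open>angle_of_rotating_unit_pair\<close>). That antiderivative exists because \<open>\<tau>\<close> is continuous, by
  the formula \<open>\<tau> = \<langle>\<alpha>''', B\<rangle> / \<kappa>\<close>. The formula for the binormal of \<open>\<beta>\<close> is then the cross product
  of \<open>b N + c B\<close> with \<open>T\<close>.
\<close>

section \<open>Calculus on an open interval\<close>

text \<open>The interval may be unbounded, so its endpoints are taken in the extended reals.\<close>

lemma antiderivative_on_open_interval:
  fixes f :: "real \<Rightarrow> real"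
  assumes I: "open I" "is_interval I" and f: "continuous_on I f"
  shows "\<exists>F. \<forall>s\<in>I. (F has_real_derivative f s) (at s)"
proof (cases "I = {}")
  case False
  define a b where "a = (INF x\<in>I. ereal x)" and "b = (SUP x\<in>I. ereal x)"
  have mem: "x \<in> I \<longleftrightarrow> a < ereal x \<and> ereal x < b" for x
  proof
    assume "x \<in> I"
    then obtain e where e: "e > 0" "cball x e \<subseteq> I"
      using I(1) open_contains_cball by blast
    have "x - e \<in> I" "x + e \<in> I"
      using e by (auto simp: dist_real_def subset_iff)
    then have "a \<le> ereal (x - e)" "ereal (x + e) \<le> b"
      by (auto simp: a_def b_def intro: INF_lower SUP_upper)
    moreover have "ereal (x - e) < ereal x" "ereal x < ereal (x + e)"
      using e(1) by auto
    ultimately show "a < ereal x \<and> ereal x < b"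
      by (meson order.strict_trans1 order.strict_trans2)
  next
    assume "a < ereal x \<and> ereal x < b"
    then obtain y z where "y \<in> I" "y < x" "z \<in> I" "x < z"
      by (auto simp: a_def b_def INF_less_iff less_SUP_iff)
    then show "x \<in> I"
      using I(2) unfolding is_interval_1 by (meson less_imp_le)
  qed
  from False have "a < b"
    using mem by (meson all_not_in_conv order.strict_trans)
  moreover have "isCont f x" if "a < ereal x" "ereal x < b" for x
    using that mem f I(1) by (simp add: continuous_on_eq_continuous_at)
  ultimately obtain F where
      "\<forall>x::real. a < x \<longrightarrow> x < b \<longrightarrow> (F has_vector_derivative f x) (at x)"
    using einterval_antiderivative by blast
  then show ?thesis
    using mem by (auto simp: has_real_derivative_iff_has_vector_derivative)
qed simp

text \<open>With \<open>\<theta>\<close> an antiderivative of \<open>\<tau>\<close>, the inner product of \<open>(b, c)\<close> with \<open>(sin \<theta>, cos \<theta>)\<close> has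
  derivative zero. The constant of \<open>\<theta>\<close> is chosen so that this inner product of unit vectors is
  \<open>1\<close> at one point; it then is \<open>1\<close> throughout, which forces the two vectors to agree.\<close>

lemma angle_of_rotating_unit_pair:
  fixes b c \<tau> :: "real \<Rightarrow> real"
  assumes I: "open I" "is_interval I" and \<tau>: "continuous_on I \<tau>"
    and b: "\<And>s. s \<in> I \<Longrightarrow> (b has_real_derivative \<tau> s * c s) (at s)"
    and c: "\<And>s. s \<in> I \<Longrightarrow> (c has_real_derivative - (\<tau> s * b s)) (at s)"
    and unit: "\<And>s. s \<in> I \<Longrightarrow> (b s)\<^sup>2 + (c s)\<^sup>2 = 1"
  shows "\<exists>\<theta>. \<forall>s\<in>I. (\<theta> has_real_derivative \<tau> s) (at s) \<and> b s = sin (\<theta> s) \<and> c s = cos (\<theta> s)"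
proof (cases "I = {}")
  case False
  then obtain s0 where s0: "s0 \<in> I"
    by blast
  obtain F where F: "\<And>s. s \<in> I \<Longrightarrow> (F has_real_derivative \<tau> s) (at s)"
    using antiderivative_on_open_interval[OF I \<tau>] by blast
  obtain \<phi> where \<phi>: "c s0 = cos \<phi>" "b s0 = sin \<phi>"
    using sincos_total_2pi[of "c s0" "b s0"] unit[OF s0] by (metis add.commute)
  define \<theta> where "\<theta> s = F s - F s0 + \<phi>" for s
  have \<theta>: "(\<theta> has_real_derivative \<tau> s) (at s)" if "s \<in> I" for s
    unfolding \<theta>_def by (auto intro!: derivative_eq_intros F that)
  define p where "p s = b s * sin (\<theta> s) + c s * cos (\<theta> s)" for s
  have "(p has_real_derivative 0) (at s)" if "s \<in> I" for s
    unfolding p_def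
    by (rule derivative_eq_intros b c \<theta> that refl | simp add: algebra_simps)+
  then have "\<exists>k. \<forall>s\<in>I. p s = k"
    using I(2) by (intro has_field_derivative_zero_constant)
      (auto simp: is_interval_convex has_field_derivative_at_within)
  moreover have "p s0 = 1"
    using sin_cos_squared_add[of \<phi>] by (simp add: p_def \<theta>_def \<phi> power2_eq_square)
  ultimately have p: "p s = 1" if "s \<in> I" for s
    using s0 that by metis
  have "b s = sin (\<theta> s) \<and> c s = cos (\<theta> s)" if "s \<in> I" for s
  proof -
    have "(b s - sin (\<theta> s))\<^sup>2 + (c s - cos (\<theta> s))\<^sup>2
        = ((b s)\<^sup>2 + (c s)\<^sup>2) + ((sin (\<theta> s))\<^sup>2 + (cos (\<theta> s))\<^sup>2) - 2 * p s"
      by (simp add: p_def power2_eq_square algebra_simps)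
    also have "\<dots> = 0"
      using unit[OF that] p[OF that] by simp
    finally show ?thesis
      by (simp add: sum_power2_eq_zero_iff)
  qed
  with \<theta> show ?thesis
    by blast
qed simp

lemma inner_has_real_derivative:
  assumes "(u has_vector_derivative u') (at s)" "(v has_vector_derivative v') (at s)"
  shows "((\<lambda>t. u t \<bullet> v t) has_real_derivative (u' \<bullet> v s + u s \<bullet> v')) (at s)"
  using bounded_bilinear.has_vector_derivative[OF bounded_bilinear_inner assms]
  by (simp add: has_real_derivative_iff_has_vector_derivative add.commute)

lemma derivative_of_constant_inner:
  assumes "open I" "s \<in> I" and const: "\<And>t. t \<in> I \<Longrightarrow> u t \<bullet> v t = k"
    and "(u has_vector_derivative u') (at s)" "(v has_vector_derivative v') (at s)"
  shows "u' \<bullet> v s + u s \<bullet> v' = 0"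
proof -
  have "((\<lambda>t. k) has_real_derivative (u' \<bullet> v s + u s \<bullet> v')) (at s)"
    using inner_has_real_derivative[OF assms(4,5)] assms(1,2) const
    by (rule has_field_derivative_transform_within_open) auto
  then show ?thesis
    using DERIV_unique DERIV_const by blast
qed

corollary derivative_of_unit_vector_orthogonal:
  assumes "open I" "s \<in> I" "\<And>t. t \<in> I \<Longrightarrow> norm (u t) = 1" "(u has_vector_derivative u') (at s)"
  shows "u s \<bullet> u' = 0"
  using derivative_of_constant_inner[OF assms(1,2) _ assms(4,4), of 1] assms(3)
  by (simp add: inner_commute dot_square_norm)

lemma cross3_has_vector_derivative:
  assumes "(u has_vector_derivative u') (at s)" "(v has_vector_derivative v') (at s)"
  shows "((\<lambda>t. cross3 (u t) (v t)) has_vector_derivative (cross3 (u s) v' + cross3 u' (v s))) (at s)"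
  using bounded_bilinear.has_vector_derivative[OF _ assms, of cross3] bilinear_cross
  by (simp add: bilinear_conv_bounded_bilinear)

text \<open>The coefficient \<open>m\<close> is the derivative of \<open>1 / \<parallel>u\<parallel>\<close>; its term disappears when the derivative
  is paired with a vector orthogonal to \<open>u s\<close>.\<close>

lemma normalized_has_vector_derivative:
  fixes u :: "real \<Rightarrow> 'a::real_inner"
  assumes u: "(u has_vector_derivative u') (at s)" and "u s \<noteq> 0"
  shows "\<exists>m. ((\<lambda>t. u t /\<^sub>R norm (u t)) has_vector_derivative (u' /\<^sub>R norm (u s) + m *\<^sub>R u s)) (at s)"
proof -
  have "(\<lambda>t. norm (u t)) differentiable (at s)"
    using differentiable_compose[of norm u s UNIV, OF differentiable_norm_at[OF \<open>u s \<noteq> 0\<close>]] u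
    by (metis differentiableI_vector)
  then have "(\<lambda>t. inverse (norm (u t))) differentiable (at s)"
    using \<open>u s \<noteq> 0\<close> by (intro differentiable_inverse) auto
  then obtain m where "((\<lambda>t. inverse (norm (u t))) has_real_derivative m) (at s)"
    using real_differentiable_def by blast
  from has_vector_derivative_scaleR[OF this u] show ?thesis
    by blast
qed

section \<open>Smooth and Frenet curves\<close>

lemma smooth_on_has_vector_derivative:
  assumes "open I" "smooth_on I f" "s \<in> I"
  shows "(f has_vector_derivative vector_derivative f (at s)) (at s)"
proof -
  from assms(2) have "f differentiable_on I"
    unfolding smooth_on_def by (auto dest: spec[of _ "0::nat"])
  with assms show ?thesis
    using differentiable_on_eq_differentiable_at vector_derivative_works by blast
qed

lemma smooth_on_vector_derivative:
  assumes "smooth_on I f"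
  shows "smooth_on I (\<lambda>s. vector_derivative f (at s))"
  unfolding smooth_on_def
proof
  let ?D = "\<lambda>g s. vector_derivative g (at s)"
  fix k
  have "(?D ^^ Suc k) f differentiable_on I"
    using assms unfolding smooth_on_def by blast
  then show "(?D ^^ k) (?D f) differentiable_on I"
    by (simp only: funpow_Suc_right o_apply)
qed

lemma smooth_on_imp_continuous_on:
  assumes "smooth_on I f"
  shows "continuous_on I f"
proof -
  from assms have "f differentiable_on I"
    unfolding smooth_on_def by (auto dest: spec[of _ "0::nat"])
  then show ?thesis
    by (rule differentiable_imp_continuous_on)
qed

lemma smooth_on_tangent: "smooth_on I \<alpha> \<Longrightarrow> smooth_on I (tangent \<alpha>)"
  using smooth_on_vector_derivative by (simp add: tangent_def[abs_def])

abbreviation acceleration :: "(real \<Rightarrow> real^3) \<Rightarrow> real \<Rightarrow> real^3" where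
  "acceleration \<alpha> s \<equiv> vector_derivative (tangent \<alpha>) (at s)"

abbreviation jerk :: "(real \<Rightarrow> real^3) \<Rightarrow> real \<Rightarrow> real^3" where
  "jerk \<alpha> s \<equiv> vector_derivative (acceleration \<alpha>) (at s)"

lemma frenet_tangent_derivative:
  assumes "open I" "frenet_curve I \<alpha>" "s \<in> I"
  shows "(tangent \<alpha> has_vector_derivative curvature \<alpha> s *\<^sub>R normal \<alpha> s) (at s)"
proof -
  have "curvature \<alpha> s *\<^sub>R normal \<alpha> s = acceleration \<alpha> s"
    using assms by (simp add: normal_def frenet_curve_def)
  then show ?thesis
    using smooth_on_has_vector_derivative[OF assms(1) smooth_on_tangent] assms
    by (simp add: frenet_curve_def)
qed

lemma frenet_orthonormal:
  assumes "open I" "frenet_curve I \<alpha>" "s \<in> I"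
  shows "norm (tangent \<alpha> s) = 1" "norm (normal \<alpha> s) = 1" "norm (binormal \<alpha> s) = 1"
    "tangent \<alpha> s \<bullet> normal \<alpha> s = 0" "tangent \<alpha> s \<bullet> binormal \<alpha> s = 0"
    "normal \<alpha> s \<bullet> binormal \<alpha> s = 0"
proof -
  have \<kappa>: "curvature \<alpha> s \<noteq> 0"
    using assms by (simp add: frenet_curve_def)
  show T: "norm (tangent \<alpha> s) = 1"
    using assms by (simp add: frenet_curve_def)
  show N: "norm (normal \<alpha> s) = 1"
    using \<kappa> by (simp add: normal_def curvature_def)
  show TN: "tangent \<alpha> s \<bullet> normal \<alpha> s = 0"
    using derivative_of_unit_vector_orthogonal[OF assms(1,3) _ frenet_tangent_derivative[OF assms]]
      assms(2) \<kappa> by (simp add: frenet_curve_def)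
  have "(norm (binormal \<alpha> s))\<^sup>2 = 1"
    using norm_cross_dot[of "tangent \<alpha> s" "normal \<alpha> s"] T N TN by (simp add: binormal_def)
  then show "norm (binormal \<alpha> s) = 1"
    by (metis norm_ge_zero one_power2 power2_eq_imp_eq zero_le_one)
  show "tangent \<alpha> s \<bullet> binormal \<alpha> s = 0" "normal \<alpha> s \<bullet> binormal \<alpha> s = 0"
    by (simp_all add: binormal_def dot_cross_self)
qed

text \<open>Only the inner products with \<open>N\<close> and \<open>B\<close> are recorded, since these are what a vector
  orthogonal to \<open>T\<close> sees of the derivatives. The last formula makes the continuity of the torsion
  visible: \<open>N'\<close> is \<open>\<alpha>''' / \<kappa>\<close> up to a multiple of \<open>\<alpha>''\<close>, which is orthogonal to \<open>B\<close>.\<close>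

lemma frenet_normal_binormal_derivatives:
  assumes "open I" "frenet_curve I \<alpha>" "s \<in> I"
  obtains N' B' where
    "(normal \<alpha> has_vector_derivative N') (at s)" "(binormal \<alpha> has_vector_derivative B') (at s)"
    "N' \<bullet> normal \<alpha> s = 0" "N' \<bullet> binormal \<alpha> s = torsion \<alpha> s"
    "B' \<bullet> normal \<alpha> s = - torsion \<alpha> s" "B' \<bullet> binormal \<alpha> s = 0"
    "torsion \<alpha> s = (jerk \<alpha> s \<bullet> binormal \<alpha> s) / curvature \<alpha> s"
proof -
  note orth = frenet_orthonormal[OF assms(1,2)]
  have A: "(acceleration \<alpha> has_vector_derivative jerk \<alpha> s) (at s)"
    using smooth_on_has_vector_derivative[OF assms(1) smooth_on_vector_derivative[OF smooth_on_tangent]]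
      assms by (simp add: frenet_curve_def)
  have \<kappa>: "curvature \<alpha> s \<noteq> 0"
    using assms by (simp add: frenet_curve_def)
  then have "acceleration \<alpha> s \<noteq> 0"
    by (simp add: curvature_def)
  with normalized_has_vector_derivative[OF A] obtain m where
    "((\<lambda>t. acceleration \<alpha> t /\<^sub>R norm (acceleration \<alpha> t)) has_vector_derivative
        (jerk \<alpha> s /\<^sub>R norm (acceleration \<alpha> s) + m *\<^sub>R acceleration \<alpha> s)) (at s)"
    by blast
  then have N: "(normal \<alpha> has_vector_derivative
        (jerk \<alpha> s /\<^sub>R curvature \<alpha> s + m *\<^sub>R acceleration \<alpha> s)) (at s)"
    by (simp add: normal_def[abs_def] curvature_def)
  define N' where "N' = jerk \<alpha> s /\<^sub>R curvature \<alpha> s + m *\<^sub>R acceleration \<alpha> s"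
  note N = N[folded N'_def]
  obtain B' where B: "(binormal \<alpha> has_vector_derivative B') (at s)"
    using cross3_has_vector_derivative[OF frenet_tangent_derivative[OF assms] N]
    by (auto simp: binormal_def[abs_def])
  have "acceleration \<alpha> s = curvature \<alpha> s *\<^sub>R normal \<alpha> s"
    using \<kappa> by (simp add: normal_def)
  then have N'B: "N' \<bullet> binormal \<alpha> s = (jerk \<alpha> s \<bullet> binormal \<alpha> s) / curvature \<alpha> s"
    using orth(6)[OF assms(3)] by (simp add: N'_def inner_add_left divide_inverse mult.commute)
  have B'N: "B' \<bullet> normal \<alpha> s = - torsion \<alpha> s"
    using vector_derivative_at[OF B] by (simp add: torsion_def)
  have "N' \<bullet> binormal \<alpha> s + normal \<alpha> s \<bullet> B' = 0"
    using derivative_of_constant_inner[OF assms(1,3) orth(6) N B] .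
  then have \<tau>: "N' \<bullet> binormal \<alpha> s = torsion \<alpha> s"
    using B'N by (simp add: inner_commute)
  show thesis
    using that[OF N B _ \<tau> B'N] \<tau> N'B
      derivative_of_unit_vector_orthogonal[OF assms(1,3) orth(2) N]
      derivative_of_unit_vector_orthogonal[OF assms(1,3) orth(3) B]
    by (simp add: inner_commute)
qed

lemma continuous_on_torsion:
  assumes "open I" "frenet_curve I \<alpha>"
  shows "continuous_on I (torsion \<alpha>)"
proof -
  have T: "smooth_on I (tangent \<alpha>)"
    using assms smooth_on_tangent by (simp add: frenet_curve_def)
  note A = smooth_on_vector_derivative[OF T]
  have \<kappa>: "continuous_on I (curvature \<alpha>)"
    unfolding curvature_def[abs_def]
    by (intro continuous_intros smooth_on_imp_continuous_on A)
  have N: "continuous_on I (normal \<alpha>)"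
    using assms unfolding normal_def[abs_def] frenet_curve_def
    by (intro continuous_intros smooth_on_imp_continuous_on A \<kappa>) auto
  have B: "continuous_on I (binormal \<alpha>)"
    unfolding binormal_def[abs_def]
    by (rule continuous_on_cross[OF smooth_on_imp_continuous_on[OF T] N])
  have "continuous_on I (\<lambda>s. (jerk \<alpha> s \<bullet> binormal \<alpha> s) / curvature \<alpha> s)"
    using assms unfolding frenet_curve_def
    by (intro continuous_intros smooth_on_imp_continuous_on smooth_on_vector_derivative[OF A] B \<kappa>)
      auto
  moreover have "torsion \<alpha> s = (jerk \<alpha> s \<bullet> binormal \<alpha> s) / curvature \<alpha> s" if "s \<in> I" for s
    using frenet_normal_binormal_derivatives[OF assms that] by metis
  ultimately show ?thesis
    by (simp cong: continuous_on_cong)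
qed

lemma frenet_binormal_cross_tangent:
  assumes "open I" "frenet_curve I \<alpha>" "s \<in> I"
  shows "cross3 (binormal \<alpha> s) (tangent \<alpha> s) = normal \<alpha> s"
proof -
  have "cross3 (binormal \<alpha> s) (tangent \<alpha> s)
      = cross3 (tangent \<alpha> s) (cross3 (normal \<alpha> s) (tangent \<alpha> s))"
    unfolding binormal_def by (metis cross_minus_right cross_skew)
  also have "\<dots> = normal \<alpha> s"
    using frenet_orthonormal[OF assms] by (simp add: Lagrange dot_square_norm)
  finally show ?thesis .
qed

section \<open>Evolute-direction curves\<close>

text \<open>A field \<open>X\<close> of which \<open>\<beta>\<close> is a direction curve is the tangent field of \<open>\<beta>\<close>; being orthogonal
  to \<open>T\<close>, it loses its first coefficient. The derivatives of the other two then follow from the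
  derivative of the tangent of \<open>\<beta>\<close> being parallel to \<open>T\<close>.\<close>

lemma evolute_tangent_coordinates:
  assumes "open I" "frenet_curve I \<alpha>" "evolute_direction_curve I \<alpha> \<beta>" "s \<in> I"
  defines "b \<equiv> \<lambda>s. tangent \<beta> s \<bullet> normal \<alpha> s" and "c \<equiv> \<lambda>s. tangent \<beta> s \<bullet> binormal \<alpha> s"
  shows "tangent \<beta> s = b s *\<^sub>R normal \<alpha> s + c s *\<^sub>R binormal \<alpha> s"
    and "(b s)\<^sup>2 + (c s)\<^sup>2 = 1"
    and "(b has_real_derivative torsion \<alpha> s * c s) (at s)"
    and "(c has_real_derivative - (torsion \<alpha> s * b s)) (at s)"
proof -
  note orth = frenet_orthonormal[OF assms(1,2,4)]
  note orth' = orth orth(4-6)[THEN trans[OF inner_commute]]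
  from assms(3) have \<beta>: "frenet_curve I \<beta>" "tangent \<beta> s \<bullet> tangent \<alpha> s = 0"
      "normal \<beta> s = tangent \<alpha> s"
    using assms(4) by (auto simp: evolute_direction_curve_def evolute_of_def)
  obtain X where X: "unit_frenet_field I \<alpha> X" "(\<beta> has_vector_derivative X s) (at s)"
    using assms(3,4) unfolding evolute_direction_curve_def direction_curve_def by blast
  then obtain x y z where xyz: "x\<^sup>2 + y\<^sup>2 + z\<^sup>2 = 1"
      "X s = x *\<^sub>R tangent \<alpha> s + y *\<^sub>R normal \<alpha> s + z *\<^sub>R binormal \<alpha> s"
    using assms(4) unfolding unit_frenet_field_def by metis
  have "tangent \<beta> s = X s"
    using vector_derivative_at[OF X(2)] by (simp add: tangent_def)
  note t = this[unfolded xyz(2)]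
  have "x = 0"
    using \<beta>(2) unfolding t by (simp add: inner_add_left orth' dot_square_norm)
  moreover have "b s = y" "c s = z"
    unfolding b_def c_def t by (simp_all add: inner_add_left orth' dot_square_norm)
  ultimately show t': "tangent \<beta> s = b s *\<^sub>R normal \<alpha> s + c s *\<^sub>R binormal \<alpha> s"
    and "(b s)\<^sup>2 + (c s)\<^sup>2 = 1"
    using t xyz(1) by simp_all
  have T': "(tangent \<beta> has_vector_derivative curvature \<beta> s *\<^sub>R tangent \<alpha> s) (at s)"
    using frenet_tangent_derivative[OF assms(1) \<beta>(1) assms(4)] \<beta>(3) by simp
  obtain N' B' where
      N: "(normal \<alpha> has_vector_derivative N') (at s)"
    and B: "(binormal \<alpha> has_vector_derivative B') (at s)"
    and coeff: "N' \<bullet> normal \<alpha> s = 0" "N' \<bullet> binormal \<alpha> s = torsion \<alpha> s"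
      "B' \<bullet> normal \<alpha> s = - torsion \<alpha> s" "B' \<bullet> binormal \<alpha> s = 0"
    using frenet_normal_binormal_derivatives[OF assms(1,2,4)] by metis
  have "tangent \<beta> s \<bullet> N' = torsion \<alpha> s * c s" "tangent \<beta> s \<bullet> B' = - (torsion \<alpha> s * b s)"
    unfolding t' by (simp_all add: inner_commute[of _ N'] inner_commute[of _ B'] inner_add_right coeff)
  then show "(b has_real_derivative torsion \<alpha> s * c s) (at s)"
    and "(c has_real_derivative - (torsion \<alpha> s * b s)) (at s)"
    using inner_has_real_derivative[OF T' N] inner_has_real_derivative[OF T' B] orth(4,5)
    unfolding b_def c_def by simp_all
qed

theorem corollary3p4:
  fixes I :: "real set" and \<alpha> \<beta> :: "real \<Rightarrow> real^3"
  assumes "open I" and "is_interval I"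
    and "frenet_curve I \<alpha>"
    and "evolute_direction_curve I \<alpha> \<beta>"
  shows "\<exists>\<theta> :: real \<Rightarrow> real.
    (\<forall>s\<in>I. (\<theta> has_real_derivative torsion \<alpha> s) (at s)) \<and>
    (\<forall>s\<in>I.
       tangent \<beta> s = sin (\<theta> s) *\<^sub>R normal \<alpha> s + cos (\<theta> s) *\<^sub>R binormal \<alpha> s \<and>
       normal \<beta> s = tangent \<alpha> s \<and>
       binormal \<beta> s = cos (\<theta> s) *\<^sub>R normal \<alpha> s - sin (\<theta> s) *\<^sub>R binormal \<alpha> s)"
proof -
  note coords = evolute_tangent_coordinates[OF assms(1,3,4)]
  obtain \<theta> where \<theta>: "\<And>s. s \<in> I \<Longrightarrow> (\<theta> has_real_derivative torsion \<alpha> s) (at s) \<and>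
      tangent \<beta> s \<bullet> normal \<alpha> s = sin (\<theta> s) \<and> tangent \<beta> s \<bullet> binormal \<alpha> s = cos (\<theta> s)"
    using angle_of_rotating_unit_pair[OF assms(1,2) continuous_on_torsion[OF assms(1,3)]
        coords(3,4,2)] by blast
  have T: "tangent \<beta> s = sin (\<theta> s) *\<^sub>R normal \<alpha> s + cos (\<theta> s) *\<^sub>R binormal \<alpha> s" if "s \<in> I" for s
    using coords(1)[OF that] \<theta>[OF that] by simp
  have N: "normal \<beta> s = tangent \<alpha> s" if "s \<in> I" for s
    using assms(4) that by (simp add: evolute_direction_curve_def evolute_of_def)
  have "binormal \<beta> s = cos (\<theta> s) *\<^sub>R normal \<alpha> s - sin (\<theta> s) *\<^sub>R binormal \<alpha> s" if "s \<in> I" for s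
  proof -
    have "cross3 (normal \<alpha> s) (tangent \<alpha> s) = - binormal \<alpha> s"
      unfolding binormal_def by (rule cross_skew)
    then show ?thesis
      unfolding binormal_def[of \<beta>] T[OF that] N[OF that]
      by (simp add: cross_add_left cross_mult_left frenet_binormal_cross_tangent[OF assms(1,3) that])
  qed
  with \<theta> T N show ?thesis
    by blast
qed

end
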